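(* There exists a strictly decreasing sequence $(\omega_m)_{m=1}^{\infty}$ of real numbers converging to $1$ such that, for every $m\in\mathbb{N}$ and every $\beta\in(1,2)$ with $\beta\in(1,\omega_m]$, $$\dim_H(\Sigma_\beta(x))\geq \frac{2m}{2m+1}\quad\text{for all } x\in\Big(0,\frac{1}{\beta-1}\Big).$$
   Context: For $1<\beta<2$ and $x\in[0,\frac{1}{\beta-1}]$, let $\Sigma_\beta(x)=\{(\epsilon_n)_{n=1}^{\infty}\in\{0,1\}^{\mathbb{N}}:\sum_{n=1}^{\infty}\epsilon_n\beta^{-n}=x\}$ be the set of $\beta$-expansions of $x$. Here $\mathbb{N}=\{1,2,3,\ldots\}$. The space $\{0,1\}^{\mathbb{N}}$ carries the metric $d(x,y)=2^{-n(x,y)}$ if $x\neq y$, where $n(x,y)=\inf\{i\ge 1:x_i\neq y_i\}$, and $d(x,x)=0$. $\dim_H$ denotes Hausdorff dimension with respect to this metric. *)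

theory Defs
  imports "HOL-Analysis.Analysis"
begin

text \<open>Digits are booleans, read as numbers through \<^term>\<open>of_bool\<close>. Positions are shifted by one:
  \<open>digit e i\<close> is the mathematical \<open>\<epsilon>\<^sub>i\<^sub>+\<^sub>1\<close>.\<close>

typedef binseq = "UNIV :: (nat \<Rightarrow> bool) set"
  morphisms digit Binseq ..

lemma binseq_eq_iff: "x = y \<longleftrightarrow> (\<forall>i. digit x i = digit y i)"
  by (simp add: digit_inject[symmetric] fun_eq_iff)

text \<open>The first position of disagreement, counted from 1. It is only meaningful if \<open>x \<noteq> y\<close>.\<close>

definition first_diff :: "binseq \<Rightarrow> binseq \<Rightarrow> nat"
  where "first_diff x y = Suc (LEAST i. digit x i \<noteq> digit y i)"

lemma first_diff_commute: "first_diff x y = first_diff y x"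
  by (simp add: first_diff_def eq_commute)

lemma first_diff_le: "digit x i \<noteq> digit y i \<Longrightarrow> first_diff x y \<le> Suc i"
  unfolding first_diff_def Suc_le_mono by (rule Least_le)

instantiation binseq :: metric_space
begin

definition dist_binseq :: "binseq \<Rightarrow> binseq \<Rightarrow> real"
  where "dist_binseq x y = (if x = y then 0 else (1 / 2) ^ first_diff x y)"

definition uniformity_binseq :: "(binseq \<times> binseq) filter"
  where "uniformity_binseq = (INF e\<in>{0 <..}. principal {(x, y). dist x y < e})"

definition open_binseq :: "binseq set \<Rightarrow> bool"
  where "open_binseq U = (\<forall>x\<in>U. eventually (\<lambda>(x', y). x' = x \<longrightarrow> y \<in> U) uniformity)"

instance
proof
  fix x y z :: binseq
  show "(uniformity :: (binseq \<times> binseq) filter) = (INF e\<in>{0 <..}. principal {(x, y). dist x y < e})"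
    by (rule uniformity_binseq_def)
  show "open U = (\<forall>x\<in>U. \<forall>\<^sub>F (x', y) in uniformity. x' = x \<longrightarrow> y \<in> U)" for U :: "binseq set"
    by (rule open_binseq_def)
  show "dist x y = 0 \<longleftrightarrow> x = y"
    by (simp add: dist_binseq_def)
  show "dist x y \<le> dist x z + dist y z"
  proof (cases "x = y \<or> x = z \<or> y = z")
    case True
    then show ?thesis by (elim disjE) (simp_all add: dist_binseq_def first_diff_commute)
  next
    case False
    let ?k = "LEAST i. digit x i \<noteq> digit y i"
    have "\<exists>i. digit x i \<noteq> digit y i"
      using False by (simp add: binseq_eq_iff)
    then have "digit x ?k \<noteq> digit y ?k"
      by (rule LeastI_ex)
    then consider "digit x ?k \<noteq> digit z ?k" | "digit y ?k \<noteq> digit z ?k" by blast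
    then show ?thesis
    proof cases
      case 1
      then have "first_diff x z \<le> first_diff x y"
        unfolding first_diff_def[of x y] by (rule first_diff_le)
      then have "(1 / 2 :: real) ^ first_diff x y \<le> (1 / 2) ^ first_diff x z"
        by (intro power_decreasing) auto
      then show ?thesis using False by (simp add: dist_binseq_def add_increasing2)
    next
      case 2
      then have "first_diff y z \<le> first_diff x y"
        unfolding first_diff_def[of x y] by (rule first_diff_le)
      then have "(1 / 2 :: real) ^ first_diff x y \<le> (1 / 2) ^ first_diff y z"
        by (intro power_decreasing) auto
      then show ?thesis using False by (simp add: dist_binseq_def add_increasing)
    qed
  qed
qed

end

text \<open>The term contributed by a covering set, with the usual conventions that the empty set
  contributes 0 and that \<open>0\<^sup>0 = 1\<close> for nonempty sets (whereas \<open>0 powr 0 = 0\<close>).\<close>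

definition diam_pow :: "real \<Rightarrow> 'a::metric_space set \<Rightarrow> real"
  where "diam_pow s U = (if U = {} then 0 else if s = 0 then 1 else diameter U powr s)"

text \<open>Boundedness is required explicitly because \<^term>\<open>diameter U\<close> is unspecified for unbounded sets.\<close>

definition hausdorff_premeasure :: "real \<Rightarrow> real \<Rightarrow> 'a::metric_space set \<Rightarrow> ennreal"
  where "hausdorff_premeasure s \<delta> S =
    (INF U \<in> {U :: nat \<Rightarrow> 'a set. S \<subseteq> (\<Union>i. U i) \<and> (\<forall>i. bounded (U i) \<and> diameter (U i) \<le> \<delta>)}.
       \<Sum>i. ennreal (diam_pow s (U i)))"

definition hausdorff_measure :: "real \<Rightarrow> 'a::metric_space set \<Rightarrow> ennreal"
  where "hausdorff_measure s S = (SUP \<delta>\<in>{0<..}. hausdorff_premeasure s \<delta> S)"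

definition hausdorff_dim :: "'a::metric_space set \<Rightarrow> ereal"
  where "hausdorff_dim S = Inf {ereal s | s. 0 \<le> s \<and> hausdorff_measure s S = 0}"

definition beta_expansions :: "real \<Rightarrow> real \<Rightarrow> binseq set"
  where "beta_expansions \<beta> x = {e. (\<lambda>i. of_bool (digit e i) / \<beta> ^ Suc i) sums x}"

end

theory Submission
  imports Defs "HOL-Real_Asymp.Real_Asymp"
begin

text \<open>
  With \<open>L = 1 / (\<beta> - 1)\<close> and the centred coordinate \<open>z = x - L / 2\<close>, choosing a first digit \<open>d\<close>
  of \<open>x\<close> moves \<open>z\<close> to \<open>\<beta> z + (1 / 2 - d)\<close>, and a digit sequence is an expansion of \<open>x\<close> as soon as
  the resulting orbit is bounded. For \<open>\<beta>\<close> near 1 the orbit is, over a bounded time, nearly a walk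
  with steps \<open>\<plusminus> 1 / 2\<close>, and exchanging the two digits reverses every step of the walk.

  Let \<open>n = 2 m + 1\<close>. A block of \<open>n\<close> digits has odd length, so its walk has a nonzero displacement of
  size at least \<open>1 / 2\<close>; either the block or its complement moves \<open>z\<close> towards 0. If \<open>\<beta> ^ n\<close> is close
  enough to 1, this inward push of \<open>1 / 2\<close> outweighs the expansion by \<open>\<beta> ^ n\<close>, and \<open>\<bar>z\<bar> \<le> n\<close> is
  preserved. So in each block one may write \<open>2 m\<close> arbitrary bits behind a leading 0 and then
  complement the whole block when the position demands it. The leading digit records whether the
  block was complemented, so the free bits can be read off from the expansion: \<open>n\<close> digits carry
  \<open>n - 1\<close> bits (\<open>flipped_blocks_form_beta_expansion\<close>).

  Taking the free bits from the binary expansion of \<open>t \<in> [0, 1)\<close> gives a map \<open>F\<close> from \<open>[0, 1)\<close> to the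
  expansions of \<open>x\<close> with \<open>\<bar>t - u\<bar> \<le> C * dist (F t) (F u) powr ((n - 1) / n)\<close>
  (\<open>central_point_parametrized\<close>). Such a map forces the Hausdorff dimension to be at least
  \<open>(n - 1) / n = 2 m / (2 m + 1)\<close>, because a cheap cover of the expansions would pull back to a cover
  of \<open>[0, 1)\<close> of total length below 1 (\<open>hausdorff_dim_ge_of_expanding_map\<close>). Points \<open>x\<close> far from the
  centre are first moved into \<open>\<bar>z\<bar> \<le> n\<close> by finitely many digits, which only changes \<open>C\<close>
  (\<open>interior_point_parametrized\<close>).
\<close>

section \<open>Dimension bounds from expanding maps\<close>

text \<open>The inverse of \<open>F\<close> is Hoelder with exponent \<open>\<theta>\<close>: it carries a set of diameter \<open>D\<close> into an interval
  of length \<open>2 C D powr \<theta>\<close>, and countably many such intervals can cover \<open>[0, 1)\<close> only if their lengths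
  add up to at least 1. Lebesgue measure thus plays the part of a mass distribution on \<open>S\<close>.\<close>

lemma hausdorff_dim_ge_of_expanding_map:
  fixes F :: "real \<Rightarrow> 'a::metric_space"
  assumes "0 < \<theta>" "0 < C" and FS: "\<And>t. t \<in> {0..<1} \<Longrightarrow> F t \<in> S"
    and holder: "\<And>t u. t \<in> {0..<1} \<Longrightarrow> u \<in> {0..<1} \<Longrightarrow> \<bar>t - u\<bar> \<le> C * dist (F t) (F u) powr \<theta>"
  shows "ereal \<theta> \<le> hausdorff_dim S"
  unfolding hausdorff_dim_def
proof (rule Inf_greatest, clarify)
  fix s :: real
  assume s: "0 \<le> s" "hausdorff_measure s S = 0"
  show "ereal \<theta> \<le> ereal s"
  proof (rule ccontr)
    assume "\<not> ereal \<theta> \<le> ereal s"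
    then have less: "s < \<theta>" by simp
    \<comment> \<open>Scale 1 suffices: sets of diameter at most 1 satisfy \<open>D powr \<theta> \<le> D powr s\<close>.\<close>
    have "ennreal (1 / (2 * C)) \<le> hausdorff_premeasure s 1 S"
      unfolding hausdorff_premeasure_def
    proof (rule INF_greatest, clarify)
      fix U :: "nat \<Rightarrow> 'a set"
      assume cover: "S \<subseteq> (\<Union>i. U i)" and small: "\<forall>i. bounded (U i) \<and> diameter (U i) \<le> 1"
      have "\<exists>I. I \<in> sets lborel \<and> {t \<in> {0..<1}. F t \<in> U i} \<subseteq> I \<and>
              emeasure lborel I \<le> ennreal (2 * C) * ennreal (diam_pow s (U i))" for i
      proof (cases "\<exists>\<tau>\<in>{0..<1}. F \<tau> \<in> U i")
        case False
        then show ?thesis by (intro exI[of _ "{}"]) auto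
      next
        case True
        then obtain \<tau> where \<tau>: "\<tau> \<in> {0..<1}" "F \<tau> \<in> U i" by auto
        define \<rho> where "\<rho> = C * diameter (U i) powr \<theta>"
        have diam: "0 \<le> diameter (U i)" "diameter (U i) \<le> 1" "bounded (U i)"
          using small by (auto simp: diameter_ge_0)
        have "{t \<in> {0..<1}. F t \<in> U i} \<subseteq> {\<tau> - \<rho>..\<tau> + \<rho>}"
        proof safe
          fix t :: real assume t: "t \<in> {0..<1}" "F t \<in> U i"
          have "dist (F t) (F \<tau>) \<le> diameter (U i)"
            using diam t \<tau> by (intro diameter_bounded_bound) auto
          then have "C * dist (F t) (F \<tau>) powr \<theta> \<le> \<rho>"
            unfolding \<rho>_def using assms(1,2) by (intro mult_left_mono powr_mono2) auto
          with holder[OF t(1) \<tau>(1)] show "t \<in> {\<tau> - \<rho>..\<tau> + \<rho>}" by auto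
        qed
        moreover have "diameter (U i) powr \<theta> \<le> diam_pow s (U i)"
        proof (cases "diameter (U i) = 0")
          case True
          then show ?thesis by (simp add: diam_pow_def)
        next
          case False
          then have "0 < diameter (U i)" using diam by simp
          then have "diameter (U i) powr \<theta> \<le> diameter (U i) powr s"
            using diam less by (intro powr_mono') auto
          moreover have "diameter (U i) powr s \<le> diam_pow s (U i)"
            using \<tau> False by (auto simp: diam_pow_def)
          ultimately show ?thesis by linarith
        qed
        then have "2 * \<rho> \<le> 2 * C * diam_pow s (U i)"
          unfolding \<rho>_def using assms(2) by (simp add: mult_left_mono)
        moreover have "0 \<le> \<rho>" unfolding \<rho>_def using assms(2) by simp
        moreover have "emeasure lborel {\<tau> - \<rho>..\<tau> + \<rho>} = ennreal (2 * \<rho>)"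
          using \<open>0 \<le> \<rho>\<close> by simp
        ultimately show ?thesis using assms(2)
          by (intro exI[of _ "{\<tau> - \<rho>..\<tau> + \<rho>}"]) (auto simp: ennreal_mult'[symmetric] ennreal_leI)
      qed
      then obtain I where I: "\<And>i. I i \<in> sets lborel" "\<And>i. {t \<in> {0..<1}. F t \<in> U i} \<subseteq> I i"
          "\<And>i. emeasure lborel (I i) \<le> ennreal (2 * C) * ennreal (diam_pow s (U i))"
        by metis
      have "{0..<1} \<subseteq> (\<Union>i. I i)"
      proof
        fix t :: real assume t: "t \<in> {0..<1}"
        then obtain i where "F t \<in> U i" using FS cover by blast
        then show "t \<in> (\<Union>i. I i)" using I(2)[of i] t by blast
      qed
      then have "emeasure lborel {0..<1::real} \<le> emeasure lborel (\<Union>i. I i)"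
        using I(1) by (intro emeasure_mono) auto
      also have "\<dots> \<le> (\<Sum>i. emeasure lborel (I i))"
        using I(1) by (intro emeasure_subadditive_countably) auto
      also have "\<dots> \<le> (\<Sum>i. ennreal (2 * C) * ennreal (diam_pow s (U i)))"
        by (intro suminf_le I(3)) auto
      also have "\<dots> = ennreal (2 * C) * (\<Sum>i. ennreal (diam_pow s (U i)))"
        by (rule ennreal_suminf_cmult)
      finally have "1 \<le> ennreal (2 * C) * (\<Sum>i. ennreal (diam_pow s (U i)))" by simp
      then have "ennreal (1 / (2 * C)) * 1 \<le>
          ennreal (1 / (2 * C)) * (ennreal (2 * C) * (\<Sum>i. ennreal (diam_pow s (U i))))"
        by (rule mult_left_mono) simp
      then show "ennreal (1 / (2 * C)) \<le> (\<Sum>i. ennreal (diam_pow s (U i)))"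
        using assms(2) by (simp add: mult.assoc[symmetric] ennreal_mult'[symmetric])
    qed
    also have "\<dots> \<le> hausdorff_measure s S"
      unfolding hausdorff_measure_def by (rule SUP_upper) simp
    finally show False using s assms(2) by (simp add: ennreal_eq_0_iff)
  qed
qed

section \<open>Binary digits\<close>

lemma floor_double: "\<lfloor>2 * (x::real)\<rfloor> = 2 * \<lfloor>x\<rfloor> + of_bool (odd \<lfloor>2 * x\<rfloor>)"
proof -
  have "\<lfloor>2 * x\<rfloor> = 2 * \<lfloor>x\<rfloor> \<or> \<lfloor>2 * x\<rfloor> = 2 * \<lfloor>x\<rfloor> + 1" by linarith
  then show ?thesis by auto
qed

definition binary_digit :: "real \<Rightarrow> nat \<Rightarrow> bool"
  where "binary_digit t i = odd \<lfloor>2 ^ Suc i * t\<rfloor>"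

text \<open>The first \<open>K\<close> digits of \<open>t\<close> determine the integer part of \<open>2 ^ K * t\<close>.\<close>

lemma close_if_binary_digits_agree:
  assumes "t \<in> {0..<1}" "u \<in> {0..<1}" and agree: "\<And>i. i < K \<Longrightarrow> binary_digit t i = binary_digit u i"
  shows "\<bar>t - u\<bar> \<le> (1 / 2) ^ K"
proof -
  have "\<lfloor>2 ^ K * t\<rfloor> = \<lfloor>2 ^ K * u\<rfloor>"
    using agree
  proof (induction K)
    case 0
    have "\<lfloor>t\<rfloor> = 0" "\<lfloor>u\<rfloor> = 0" using assms by (auto simp: floor_eq_iff)
    then show ?case by simp
  next
    case (Suc K)
    then have "\<lfloor>2 ^ K * t\<rfloor> = \<lfloor>2 ^ K * u\<rfloor>" by simp
    then show ?case
      using Suc.prems[of K] floor_double[of "2 ^ K * t"] floor_double[of "2 ^ K * u"]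
      by (simp add: binary_digit_def mult.assoc)
  qed
  then have "\<bar>2 ^ K * t - 2 ^ K * u\<bar> \<le> 1" by linarith
  then have "2 ^ K * \<bar>t - u\<bar> \<le> 1"
    by (simp add: right_diff_distrib[symmetric] abs_mult)
  then show ?thesis by (simp add: field_simps)
qed

section \<open>Centred orbits\<close>

text \<open>The remainder of a number after \<open>i\<close> digits have been chosen, measured from the midpoint
  \<open>1 / (2 * (\<beta> - 1))\<close> of the interval of expandable numbers. Centring makes the two digits act
  symmetrically, by \<open>\<plusminus> 1 / 2\<close>.\<close>

fun orbit :: "real \<Rightarrow> (nat \<Rightarrow> bool) \<Rightarrow> real \<Rightarrow> nat \<Rightarrow> real" where
  "orbit \<beta> d z 0 = z"
| "orbit \<beta> d z (Suc i) = \<beta> * orbit \<beta> d z i + (1 / 2 - of_bool (d i))"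

lemma orbit_cong: "(\<And>i. i < j \<Longrightarrow> d i = d' i) \<Longrightarrow> orbit \<beta> d z j = orbit \<beta> d' z j"
  by (induction j) auto

lemma orbit_add: "orbit \<beta> d z (a + b) = orbit \<beta> (\<lambda>i. d (a + i)) (orbit \<beta> d z a) b"
  by (induction b) auto

text \<open>The error of the \<open>k\<close>-th partial sum is the uncentred orbit \<open>y k\<close> divided by \<open>\<beta> ^ k\<close>.\<close>

lemma beta_expansion_if_bounded_orbit:
  assumes "1 < \<beta>" and bound: "\<And>i. \<bar>orbit \<beta> (digit e) (x - 1 / (2 * (\<beta> - 1))) i\<bar> \<le> B"
  shows "e \<in> beta_expansions \<beta> x"
proof -
  define y where "y = (\<lambda>i. orbit \<beta> (digit e) (x - 1 / (2 * (\<beta> - 1))) i + 1 / (2 * (\<beta> - 1)))"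
  have y_Suc: "y (Suc i) = \<beta> * y i - of_bool (digit e i)" for i
    using assms(1) by (simp add: y_def field_simps)
  have partial: "(\<Sum>i<k. of_bool (digit e i) / \<beta> ^ Suc i) = x - y k / \<beta> ^ k" for k
  proof (induction k)
    case 0
    then show ?case by (simp add: y_def)
  next
    case (Suc k)
    have "y (Suc k) / \<beta> ^ Suc k = y k / \<beta> ^ k - of_bool (digit e k) / \<beta> ^ Suc k"
      using assms(1) by (simp add: y_Suc diff_divide_distrib)
    with Suc show ?case by simp
  qed
  have "(\<lambda>k. y k / \<beta> ^ k) \<longlonglongrightarrow> 0"
  proof (rule Lim_null_comparison)
    show "\<forall>\<^sub>F k in sequentially. norm (y k / \<beta> ^ k) \<le> (B + 1 / (2 * (\<beta> - 1))) * (1 / \<beta>) ^ k"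
    proof (intro always_eventually allI)
      fix k
      have "\<bar>y k\<bar> \<le> B + 1 / (2 * (\<beta> - 1))"
        unfolding y_def using bound[of k] assms(1) by (intro order_trans[OF abs_triangle_ineq]) simp
      then show "norm (y k / \<beta> ^ k) \<le> (B + 1 / (2 * (\<beta> - 1))) * (1 / \<beta>) ^ k"
        using assms(1) by (simp add: power_one_over divide_right_mono)
    qed
    have "(\<lambda>k. (1 / \<beta>) ^ k) \<longlonglongrightarrow> 0"
      using assms(1) by (intro LIMSEQ_power_zero) simp
    then show "(\<lambda>k. (B + 1 / (2 * (\<beta> - 1))) * (1 / \<beta>) ^ k) \<longlonglongrightarrow> 0"
      by (rule tendsto_mult_right_zero)
  qed
  then have "(\<lambda>k. x - y k / \<beta> ^ k) \<longlonglongrightarrow> x - 0"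
    by (intro tendsto_diff tendsto_const)
  then show ?thesis
    unfolding beta_expansions_def sums_def mem_Collect_eq partial by simp
qed

lemma walk_bound: "\<bar>\<Sum>i<j. 1 / 2 - of_bool (d i) :: real\<bar> \<le> real j / 2"
proof -
  have "\<bar>\<Sum>i<j. 1 / 2 - of_bool (d i) :: real\<bar> \<le> (\<Sum>i<j. 1 / 2)"
    by (rule order_trans[OF sum_abs sum_mono]) auto
  then show ?thesis by simp
qed

text \<open>The expansion by \<open>\<beta>\<close> is the only reason why the orbit differs from a walk with steps \<open>\<plusminus> 1 / 2\<close>.
  Each step adds \<open>(\<beta> - 1)\<close> times the current position to the error, and the position itself is at
  most \<open>\<beta> ^ j * (\<bar>z\<bar> + j / 2)\<close>; the errors telescope to the factor \<open>\<beta> ^ j - 1\<close>.\<close>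

lemma orbit_near_walk:
  assumes "1 < \<beta>"
  shows "\<bar>orbit \<beta> d z j - (z + (\<Sum>i<j. 1 / 2 - of_bool (d i)))\<bar> \<le> (\<beta> ^ j - 1) * (\<bar>z\<bar> + real j / 2)"
proof (induction j)
  case 0
  then show ?case by simp
next
  case (Suc j)
  define W where "W = (\<Sum>i<j. 1 / 2 - of_bool (d i) :: real)"
  define q where "q = orbit \<beta> d z j"
  have W: "\<bar>W\<bar> \<le> real j / 2" unfolding W_def by (rule walk_bound)
  have pow: "1 \<le> \<beta> ^ j" "1 \<le> \<beta> ^ Suc j" using assms by (intro one_le_power; simp)+
  have IH: "\<bar>q - (z + W)\<bar> \<le> (\<beta> ^ j - 1) * (\<bar>z\<bar> + real j / 2)"
    using Suc unfolding W_def q_def .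
  moreover have "\<bar>q\<bar> \<le> \<bar>q - (z + W)\<bar> + (\<bar>z\<bar> + \<bar>W\<bar>)" by linarith
  ultimately have "\<bar>q\<bar> \<le> (\<beta> ^ j - 1) * (\<bar>z\<bar> + real j / 2) + (\<bar>z\<bar> + real j / 2)"
    using W by linarith
  also have "\<dots> = \<beta> ^ j * (\<bar>z\<bar> + real j / 2)" by (simp add: left_diff_distrib)
  finally have "\<bar>q\<bar> \<le> \<beta> ^ j * (\<bar>z\<bar> + real j / 2)" .
  then have "\<bar>(\<beta> - 1) * q\<bar> \<le> (\<beta> - 1) * (\<beta> ^ j * (\<bar>z\<bar> + real j / 2))"
    using assms by (simp add: abs_mult)
  with IH have "\<bar>q - (z + W) + (\<beta> - 1) * q\<bar> \<le>
      (\<beta> ^ j - 1) * (\<bar>z\<bar> + real j / 2) + (\<beta> - 1) * (\<beta> ^ j * (\<bar>z\<bar> + real j / 2))"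
    by linarith
  also have "\<dots> = (\<beta> ^ Suc j - 1) * (\<bar>z\<bar> + real j / 2)"
    by (simp add: left_diff_distrib mult.assoc)
  also have "\<dots> \<le> (\<beta> ^ Suc j - 1) * (\<bar>z\<bar> + real (Suc j) / 2)"
    using pow by (intro mult_left_mono) auto
  finally show ?case
    by (simp add: W_def[symmetric] q_def[symmetric] algebra_simps)
qed

section \<open>Blocks with one control digit\<close>

text \<open>Complementing the block negates the displacement \<open>W\<close> of its walk, and \<open>W \<noteq> 0\<close> by parity, so one
  of the two versions moves \<open>z\<close> by at least \<open>1 / 2\<close> towards the origin. The bound on \<open>\<beta> ^ n\<close> is chosen
  such that the deviation from the walk is at most \<open>(\<beta> ^ n - 1) * (n + n / 2) \<le> 1 / 2\<close>. Overshooting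
  is harmless since \<open>\<bar>W\<bar> \<le> n / 2\<close>.\<close>

lemma block_can_be_flipped_inward:
  fixes v :: "nat \<Rightarrow> bool"
  assumes "1 < \<beta>" "odd n" and small: "\<beta> ^ n \<le> 1 + 1 / (3 * real n)" and z: "\<bar>z\<bar> \<le> real n"
  shows "\<exists>c. \<bar>orbit \<beta> (\<lambda>j. v j \<noteq> c) z n\<bar> \<le> real n"
proof -
  have n: "1 \<le> real n" using \<open>odd n\<close> by (cases n) auto
  define W where "W = (\<lambda>c :: bool. \<Sum>j<n. 1 / 2 - of_bool (v j \<noteq> c) :: real)"
  have W_flip: "W True = - W False"
    unfolding W_def sum_negf[symmetric] by (rule sum.cong) auto
  have W_le: "\<bar>W c\<bar> \<le> real n / 2" for c unfolding W_def by (rule walk_bound)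
  have W_ge: "1 / 2 \<le> \<bar>W False\<bar>"
  proof -
    define k where "k = (\<Sum>j<n. of_bool (v j) :: int)"
    have "2 * W False = of_int (int n - 2 * k)"
      by (simp add: W_def k_def sum_subtractf)
    moreover have "int n - 2 * k \<noteq> 0" using \<open>odd n\<close> by presburger
    then have "1 \<le> \<bar>int n - 2 * k\<bar>" by linarith
    then have "1 \<le> \<bar>of_int (int n - 2 * k) :: real\<bar>" by linarith
    ultimately show ?thesis by linarith
  qed
  obtain c where c: "(0 \<le> z \<and> W c \<le> - 1 / 2) \<or> (z \<le> 0 \<and> 1 / 2 \<le> W c)"
  proof (cases "0 \<le> z \<longleftrightarrow> 0 \<le> W False")
    case True
    then show ?thesis using that[of True] W_flip W_ge by linarith
  next
    case False
    then show ?thesis using that[of False] W_ge by linarith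
  qed
  have "(\<beta> ^ n - 1) * (\<bar>z\<bar> + real n / 2) \<le> 1 / (3 * real n) * (3 * real n / 2)"
    using small z n by (intro mult_mono) auto
  also have "\<dots> = 1 / 2" using n by simp
  finally have "\<bar>orbit \<beta> (\<lambda>j. v j \<noteq> c) z n - (z + W c)\<bar> \<le> 1 / 2"
    unfolding W_def by (rule order_trans[OF orbit_near_walk[OF assms(1)]])
  then have "\<bar>orbit \<beta> (\<lambda>j. v j \<noteq> c) z n\<bar> \<le> real n"
    using c W_le[of c] z n by (simp only: abs_le_iff) linarith
  then show ?thesis ..
qed

text \<open>Whether the block \<open>w k\<close> is complemented depends on the position
  \<open>Z k\<close> reached after the previous blocks, so the flips are chosen one after the other along with
  these positions.\<close>

lemma flipped_blocks_form_beta_expansion: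
  fixes w :: "nat \<Rightarrow> nat \<Rightarrow> bool"
  assumes "1 < \<beta>" "odd n" and small: "\<beta> ^ n \<le> 1 + 1 / (3 * real n)"
    and x: "\<bar>x - 1 / (2 * (\<beta> - 1))\<bar> \<le> real n"
  shows "\<exists>c. Binseq (\<lambda>i. w (i div n) (i mod n) \<noteq> c (i div n)) \<in> beta_expansions \<beta> x"
proof -
  have n: "0 < n" using \<open>odd n\<close> by (cases n) auto
  have "\<exists>Z. \<forall>k. (\<bar>Z k\<bar> \<le> real n \<and> (k = 0 \<longrightarrow> Z k = x - 1 / (2 * (\<beta> - 1)))) \<and>
      (\<exists>c. Z (Suc k) = orbit \<beta> (\<lambda>j. w k j \<noteq> c) (Z k) n)"
  proof (rule dependent_nat_choice)
    show "\<exists>z. \<bar>z\<bar> \<le> real n \<and> (0 = (0::nat) \<longrightarrow> z = x - 1 / (2 * (\<beta> - 1)))" using x by auto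
    show "\<exists>z'. (\<bar>z'\<bar> \<le> real n \<and> (Suc k = 0 \<longrightarrow> z' = x - 1 / (2 * (\<beta> - 1)))) \<and>
        (\<exists>c. z' = orbit \<beta> (\<lambda>j. w k j \<noteq> c) z n)"
      if "\<bar>z\<bar> \<le> real n \<and> (k = 0 \<longrightarrow> z = x - 1 / (2 * (\<beta> - 1)))" for z k
      using block_can_be_flipped_inward[OF assms(1-3), of z "w k"] that by auto
  qed
  then obtain Z c where Z0: "Z 0 = x - 1 / (2 * (\<beta> - 1))" and Z: "\<And>k. \<bar>Z k\<bar> \<le> real n"
    and Z_Suc: "\<And>k. Z (Suc k) = orbit \<beta> (\<lambda>j. w k j \<noteq> c k) (Z k) n"
    by metis
  define d where "d = (\<lambda>i. w (i div n) (i mod n) \<noteq> c (i div n))"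
  have block: "orbit \<beta> (\<lambda>i. d (k * n + i)) z j = orbit \<beta> (\<lambda>j. w k j \<noteq> c k) z j" if "j \<le> n" for k j z
    using that n by (intro orbit_cong) (auto simp: d_def)
  have at_block: "orbit \<beta> d (Z 0) (k * n) = Z k" for k
  proof (induction k)
    case 0
    then show ?case by simp
  next
    case (Suc k)
    have "orbit \<beta> d (Z 0) (Suc k * n) = orbit \<beta> d (Z 0) (k * n + n)" by (simp add: add.commute)
    then show ?case by (simp add: orbit_add Suc.IH block Z_Suc)
  qed
  have "\<bar>orbit \<beta> d (Z 0) i\<bar> \<le> \<beta> ^ n * (2 * real n)" for i
  proof -
    define k j where "k = i div n" and "j = i mod n"
    have j: "j < n" using n by (simp add: j_def)
    define W where "W = (\<Sum>i<j. 1 / 2 - of_bool (w k i \<noteq> c k) :: real)"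
    have W: "\<bar>W\<bar> \<le> real j / 2" unfolding W_def by (rule walk_bound)
    have "orbit \<beta> d (Z 0) i = orbit \<beta> d (Z 0) (k * n + j)" by (simp add: k_def j_def)
    also have "\<dots> = orbit \<beta> (\<lambda>j. w k j \<noteq> c k) (Z k) j"
      using j by (simp add: orbit_add at_block block)
    finally have "\<bar>orbit \<beta> d (Z 0) i\<bar> \<le> \<bar>Z k\<bar> + real j / 2 + (\<beta> ^ j - 1) * (\<bar>Z k\<bar> + real j / 2)"
      using orbit_near_walk[OF assms(1), of "\<lambda>j. w k j \<noteq> c k" "Z k" j] W
      unfolding W_def[symmetric] by linarith
    also have "\<dots> = \<beta> ^ j * (\<bar>Z k\<bar> + real j / 2)" by (simp add: left_diff_distrib)
    also have "\<dots> \<le> \<beta> ^ n * (2 * real n)"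
      using j Z[of k] assms(1) by (intro mult_mono power_increasing) auto
    finally show ?thesis .
  qed
  then have "Binseq d \<in> beta_expansions \<beta> x"
    using assms(1) by (intro beta_expansion_if_bounded_orbit) (auto simp: Binseq_inverse Z0)
  then show ?thesis unfolding d_def by blast
qed

text \<open>The constant \<open>C\<close> is left existential so that the property survives the insertion of leading digits.\<close>

definition expandingly_parametrized :: "real \<Rightarrow> 'a::metric_space set \<Rightarrow> bool"
  where "expandingly_parametrized \<theta> S \<longleftrightarrow> (\<exists>F C. 0 < C \<and> (\<forall>t\<in>{0..<1}. F t \<in> S) \<and>
    (\<forall>t\<in>{0..<1::real}. \<forall>u\<in>{0..<1}. \<bar>t - u\<bar> \<le> C * dist (F t) (F u) powr \<theta>))"

lemma hausdorff_dim_ge_if_expandingly_parametrized: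
  "0 < \<theta> \<Longrightarrow> expandingly_parametrized \<theta> S \<Longrightarrow> ereal \<theta> \<le> hausdorff_dim S"
  unfolding expandingly_parametrized_def by (blast intro: hausdorff_dim_ge_of_expanding_map)

text \<open>Each block consists of a leading 0 and \<open>n - 1\<close> binary digits of \<open>t\<close>, all complemented if \<open>c t k\<close>
  holds. Its first digit is therefore \<open>c t k\<close> itself, so agreement of \<open>F t\<close> and \<open>F u\<close> on whole blocks
  implies agreement of the binary digits behind them, although the flips for \<open>t\<close> and \<open>u\<close> come from
  unrelated choices. The constant \<open>2 ^ (n - 1)\<close> pays for the block in which the first
  difference occurs.\<close>

lemma central_point_parametrized:
  assumes "1 < \<beta>" "odd n" "1 < n" and small: "\<beta> ^ n \<le> 1 + 1 / (3 * real n)"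
    and x: "\<bar>x - 1 / (2 * (\<beta> - 1))\<bar> \<le> real n"
  shows "expandingly_parametrized (real (n - 1) / real n) (beta_expansions \<beta> x)"
proof -
  define \<theta> where "\<theta> = real (n - 1) / real n"
  define w where "w = (\<lambda>t k j. j \<noteq> 0 \<and> binary_digit t (k * (n - 1) + (j - 1)))"
  have "\<forall>t. \<exists>c. Binseq (\<lambda>i. w t (i div n) (i mod n) \<noteq> c (i div n)) \<in> beta_expansions \<beta> x"
    using flipped_blocks_form_beta_expansion[OF assms(1,2) small x] by blast
  then obtain c where c:
    "\<And>t. Binseq (\<lambda>i. w t (i div n) (i mod n) \<noteq> c t (i div n)) \<in> beta_expansions \<beta> x"
    by metis
  define F where "F = (\<lambda>t. Binseq (\<lambda>i. w t (i div n) (i mod n) \<noteq> c t (i div n)))"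
  have digit_F: "digit (F t) (k * n + j) \<longleftrightarrow> (w t k j \<noteq> c t k)" if "j < n" for t k j
    using that by (simp add: F_def Binseq_inverse)
  have close: "\<bar>t - u\<bar> \<le> (1 / 2) ^ (k * (n - 1))"
    if t: "t \<in> {0..<1}" "u \<in> {0..<1}" and agree: "\<And>i. i < k * n \<Longrightarrow> digit (F t) i = digit (F u) i"
    for t u k
  proof (rule close_if_binary_digits_agree[OF t])
    fix i assume i: "i < k * (n - 1)"
    define q r where "q = i div (n - 1)" and "r = i mod (n - 1)"
    have r: "r < n - 1" using assms(3) by (simp add: r_def)
    have q: "q < k" using i by (simp add: q_def less_mult_imp_div_less)
    have qr: "i = q * (n - 1) + r" unfolding q_def r_def by (rule div_mult_mod_eq[symmetric])
    have lt: "q * n + j < k * n" if "j < n" for j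
    proof -
      have "q * n + j < Suc q * n" using that by simp
      also have "\<dots> \<le> k * n" using q by (intro mult_le_mono1) simp
      finally show ?thesis .
    qed
    \<comment> \<open>The leading digit of block \<open>q\<close> reveals its flip; undoing the flip reveals the other digits.\<close>
    have "c t q = c u q"
      using agree[OF lt[of 0]] digit_F[of 0 _ q] assms(3) by (auto simp: w_def)
    moreover have "(w t q (Suc r) \<noteq> c t q) = (w u q (Suc r) \<noteq> c u q)"
      using agree[OF lt[of "Suc r"]] digit_F[of "Suc r" _ q] r by simp
    ultimately have "w t q (Suc r) = w u q (Suc r)" by auto
    then show "binary_digit t i = binary_digit u i" by (simp add: w_def qr)
  qed
  have "\<bar>t - u\<bar> \<le> 2 ^ (n - 1) * dist (F t) (F u) powr \<theta>"
    if t: "t \<in> {0..<1}" "u \<in> {0..<1}" for t u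
  proof (cases "F t = F u")
    case True
    have "\<bar>t - u\<bar> \<le> (1 / 2) ^ k" for k
    proof -
      have "\<bar>t - u\<bar> \<le> (1 / 2) ^ (k * (n - 1))" using True by (intro close t) simp
      also have "\<dots> \<le> (1 / 2) ^ k" using assms(3) by (intro power_decreasing) auto
      finally show ?thesis .
    qed
    moreover have "(\<lambda>k. (1 / 2) ^ k :: real) \<longlonglongrightarrow> 0" by (rule LIMSEQ_power_zero) simp
    ultimately have "\<bar>t - u\<bar> \<le> 0" by (intro LIMSEQ_le_const) auto
    then show ?thesis by simp
  next
    case False
    define i where "i = (LEAST i. digit (F t) i \<noteq> digit (F u) i)"
    define k where "k = i div n"
    have "k * n \<le> i" by (simp add: k_def)
    have "i < Suc k * n" using dividend_less_div_times[of n i] assms(3) by (simp add: k_def)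
    have "digit (F t) j = digit (F u) j" if "j < k * n" for j
      using not_less_Least[of j "\<lambda>i. digit (F t) i \<noteq> digit (F u) i"] that \<open>k * n \<le> i\<close>
      unfolding i_def by linarith
    then have "\<bar>t - u\<bar> \<le> (1 / 2) ^ (k * (n - 1))" by (intro close t) auto
    also have "\<dots> = 2 ^ (n - 1) * (1 / 2) ^ (Suc k * (n - 1))"
      by (simp add: power_add power_one_over)
    also have "(1 / 2 :: real) ^ (Suc k * (n - 1)) = ((1 / 2) ^ (Suc k * n)) powr \<theta>"
    proof -
      have "real (Suc k * n) * \<theta> = real (Suc k * (n - 1))"
        using assms(3) unfolding \<theta>_def of_nat_mult by simp
      then show ?thesis
        by (subst (1 2) powr_realpow[symmetric]) (simp_all add: powr_powr del: of_nat_mult of_nat_Suc mult_Suc)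
    qed
    also have "\<dots> \<le> dist (F t) (F u) powr \<theta>"
    proof (rule powr_mono2)
      show "(1 / 2) ^ (Suc k * n) \<le> dist (F t) (F u)"
        using False \<open>i < Suc k * n\<close> unfolding dist_binseq_def first_diff_def i_def[symmetric]
        by (simp add: power_decreasing del: power_Suc mult_Suc)
    qed (auto simp: \<theta>_def)
    finally show ?thesis by simp
  qed
  then show ?thesis
    unfolding expandingly_parametrized_def \<theta>_def[symmetric]
    using c by (intro exI[of _ F] exI[of _ "2 ^ (n - 1)"]) (auto simp: F_def)
qed

section \<open>Reaching the centre\<close>

definition prepend :: "bool \<Rightarrow> binseq \<Rightarrow> binseq"
  where "prepend b e = Binseq (case_nat b (digit e))"

lemma digit_prepend [simp]:
  "digit (prepend b e) 0 = b" "digit (prepend b e) (Suc i) = digit e i"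
  by (simp_all add: prepend_def Binseq_inverse)

lemma dist_prepend: "dist (prepend b e) (prepend b f) = dist e f / 2"
proof (cases "e = f")
  case False
  then obtain i where i: "digit e i \<noteq> digit f i" by (auto simp: binseq_eq_iff)
  have "(LEAST i. digit (prepend b e) i \<noteq> digit (prepend b f) i) =
      Suc (LEAST i. digit (prepend b e) (Suc i) \<noteq> digit (prepend b f) (Suc i))"
    by (rule Least_Suc[of _ "Suc i"]) (use i in auto)
  moreover have "prepend b e \<noteq> prepend b f"
    using i by (auto simp: binseq_eq_iff intro!: exI[of _ "Suc i"])
  ultimately show ?thesis using False by (simp add: dist_binseq_def first_diff_def)
qed simp

lemma prepend_beta_expansion:
  assumes "0 < \<beta>" "e \<in> beta_expansions \<beta> (\<beta> * x - of_bool b)"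
  shows "prepend b e \<in> beta_expansions \<beta> x"
proof -
  have "(\<lambda>i. of_bool (digit e i) / \<beta> ^ Suc i / \<beta>) sums ((\<beta> * x - of_bool b) / \<beta>)"
    using assms(2) unfolding beta_expansions_def by (intro sums_divide) simp
  also have "(\<lambda>i. of_bool (digit e i) / \<beta> ^ Suc i / \<beta>) =
      (\<lambda>i. of_bool (digit (prepend b e) (Suc i)) / \<beta> ^ Suc (Suc i))"
    by (simp add: field_simps)
  also have "(\<beta> * x - of_bool b) / \<beta> = x - of_bool (digit (prepend b e) 0) / \<beta> ^ Suc 0"
    using assms(1) by (simp add: field_simps)
  finally show ?thesis
    unfolding beta_expansions_def mem_Collect_eq
    by (subst (asm) sums_Suc_iff[of "\<lambda>i. of_bool (digit (prepend b e) i) / \<beta> ^ Suc i"])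
      (simp only: diff_add_cancel)
qed

lemma parametrized_if_successor_parametrized:
  assumes "0 < \<beta>" "expandingly_parametrized \<theta> (beta_expansions \<beta> (\<beta> * x - of_bool b))"
  shows "expandingly_parametrized \<theta> (beta_expansions \<beta> x)"
proof -
  obtain F C where F: "0 < C" "\<And>t. t \<in> {0..<1} \<Longrightarrow> F t \<in> beta_expansions \<beta> (\<beta> * x - of_bool b)"
    "\<And>t u. t \<in> {0..<1} \<Longrightarrow> u \<in> {0..<1} \<Longrightarrow> \<bar>t - u\<bar> \<le> C * dist (F t) (F u) powr \<theta>"
    using assms(2) unfolding expandingly_parametrized_def by blast
  have "C * dist (F t) (F u) powr \<theta> =
      C * 2 powr \<theta> * dist (prepend b (F t)) (prepend b (F u)) powr \<theta>" for t u
    by (simp add: dist_prepend powr_divide)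
  then show ?thesis
    unfolding expandingly_parametrized_def
    using F prepend_beta_expansion[OF assms(1)]
    by (intro exI[of _ "\<lambda>t. prepend b (F t)"] exI[of _ "C * 2 powr \<theta>"]) (auto simp: mult.assoc)
qed

text \<open>Off the centre, choose the digit whose step \<open>\<plusminus> 1 / 2\<close> points inwards. Multiplication by \<open>\<beta>\<close> pushes
  outwards by \<open>(\<beta> - 1) * \<bar>y - L\<bar>\<close>, which stays below \<open>1 / 2\<close> by a fixed amount \<open>\<delta>\<close> as long as \<open>y\<close> is no
  further from the midpoint \<open>L\<close> than the given interior point \<open>x\<close>. Hence the distance to \<open>L\<close> shrinks
  by at least \<open>\<delta>\<close> per digit until it is at most \<open>C\<close>; the hypothesis \<open>1 \<le> C\<close> excludes overshooting.\<close>

lemma interior_point_parametrized: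
  assumes "1 < \<beta>" "1 \<le> C"
    and central: "\<And>x. \<bar>x - 1 / (2 * (\<beta> - 1))\<bar> \<le> C \<Longrightarrow> expandingly_parametrized \<theta> (beta_expansions \<beta> x)"
    and x: "x \<in> {0<..<1 / (\<beta> - 1)}"
  shows "expandingly_parametrized \<theta> (beta_expansions \<beta> x)"
proof -
  define L where "L = 1 / (2 * (\<beta> - 1))"
  have L: "(\<beta> - 1) * L = 1 / 2" using assms(1) by (simp add: L_def)
  define r where "r = \<bar>x - L\<bar>"
  have "1 / (\<beta> - 1) = 2 * L" using assms(1) by (simp add: L_def field_simps)
  then have "r < L" using x by (auto simp: r_def)
  define \<delta> where "\<delta> = 1 / 2 - (\<beta> - 1) * r"
  have "(\<beta> - 1) * r < (\<beta> - 1) * L"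
    using \<open>r < L\<close> assms(1) by (intro mult_strict_left_mono) auto
  then have \<delta>: "0 < \<delta>" using L by (simp add: \<delta>_def)
  have "expandingly_parametrized \<theta> (beta_expansions \<beta> y)"
    if "\<bar>y - L\<bar> \<le> r" "\<bar>y - L\<bar> \<le> C + real N * \<delta>" for y N
    using that
  proof (induction N arbitrary: y)
    case 0
    then show ?case by (intro central) (simp add: L_def)
  next
    case (Suc N)
    show ?case
    proof (cases "\<bar>y - L\<bar> \<le> C")
      case True
      then show ?thesis by (intro central) (simp add: L_def)
    next
      case False
      define b where "b \<longleftrightarrow> L \<le> y"
      define z where "z = (\<beta> * y - of_bool b) - L"
      have "z = (y - L) + (\<beta> - 1) * (y - L) + (1 / 2 - of_bool b)"
        using L by (simp add: z_def algebra_simps)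
      moreover have "(\<beta> - 1) * \<bar>y - L\<bar> \<le> (\<beta> - 1) * r"
        using Suc.prems assms(1) by (intro mult_left_mono) auto
      then have "\<bar>(\<beta> - 1) * (y - L)\<bar> \<le> 1 / 2 - \<delta>"
        using assms(1) by (simp add: \<delta>_def abs_mult)
      moreover have "0 \<le> (\<beta> - 1) * (y - L) \<longleftrightarrow> b"
        using assms(1) by (simp add: b_def zero_le_mult_iff)
      ultimately have "\<bar>z\<bar> \<le> \<bar>y - L\<bar> - \<delta>"
        using False assms(2) \<delta> by (cases b) (auto simp: b_def)
      then have "expandingly_parametrized \<theta> (beta_expansions \<beta> (\<beta> * y - of_bool b))"
        using Suc.prems \<delta> unfolding z_def by (intro Suc.IH) (simp_all add: distrib_right)
      then show ?thesis
        using assms(1) by (intro parametrized_if_successor_parametrized[of \<beta> \<theta> y b]) auto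
    qed
  qed
  moreover obtain N where "r / \<delta> < real N" using reals_Archimedean2 by blast
  then have "r \<le> C + real N * \<delta>" using \<delta> assms(2) by (simp add: field_simps)
  ultimately show ?thesis by (simp add: r_def)
qed

section \<open>Thresholds for the base\<close>

text \<open>With \<open>n = 2 m + 1\<close> this is \<open>1 + 1 / (6 n\<^sup>2)\<close>, whose \<open>n\<close>-th power is about \<open>1 + 1 / (6 n)\<close> and so
  leaves a factor 2 of room below the bound \<open>1 + 1 / (3 n)\<close> required of \<open>\<beta> ^ n\<close>.\<close>

definition threshold :: "nat \<Rightarrow> real"
  where "threshold m = 1 + 1 / (6 * (2 * real m + 1)\<^sup>2)"

lemma power_le_if_le_threshold:
  assumes "1 < \<beta>" "\<beta> \<le> threshold m"
  shows "\<beta> ^ (2 * m + 1) \<le> 1 + 1 / (3 * real (2 * m + 1))"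
proof -
  define n where "n = 2 * real m + 1"
  have n: "1 \<le> n" by (simp add: n_def)
  define a where "a = 1 / (6 * n)"
  have a: "0 \<le> a" "a \<le> 1" using n by (auto simp: a_def)
  have "\<beta> \<le> 1 + 1 / (6 * n\<^sup>2)" using assms by (simp add: threshold_def n_def)
  also have "\<dots> \<le> exp (1 / (6 * n\<^sup>2))" by (rule exp_ge_add_one_self)
  finally have "\<beta> ^ (2 * m + 1) \<le> exp (1 / (6 * n\<^sup>2)) ^ (2 * m + 1)"
    using assms(1) by (intro power_mono) auto
  also have "\<dots> = exp (real (2 * m + 1) * (1 / (6 * n\<^sup>2)))" by (rule exp_of_nat_mult[symmetric])
  also have "real (2 * m + 1) * (1 / (6 * n\<^sup>2)) = a"
  proof -
    have "real (2 * m + 1) = n" by (simp add: n_def)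
    then show ?thesis using n by (simp add: a_def power2_eq_square)
  qed
  also have "exp a \<le> 1 + a + a\<^sup>2" using a by (intro exp_bound) auto
  also have "\<dots> \<le> 1 + 2 * a" using a by (simp add: power2_eq_square mult_left_le)
  also have "\<dots> = 1 + 1 / (3 * n)" by (simp add: a_def)
  also have "n = real (2 * m + 1)" by (simp add: n_def)
  finally show ?thesis .
qed

theorem theorem1p3:
  "\<exists>\<omega> :: nat \<Rightarrow> real.
     strict_antimono_on {1..} \<omega> \<and> \<omega> \<longlonglongrightarrow> 1 \<and>
     (\<forall>m\<ge>1. \<forall>\<beta>\<in>{1<..<2}. \<beta> \<in> {1<..\<omega> m} \<longrightarrow>
        (\<forall>x\<in>{0<..<1 / (\<beta> - 1)}.
           hausdorff_dim (beta_expansions \<beta> x) \<ge> ereal (2 * real m / (2 * real m + 1))))"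
proof (intro exI[of _ threshold] conjI allI impI ballI)
  show "strict_antimono_on {1..} threshold"
    unfolding monotone_on_def threshold_def
    by (auto intro!: divide_strict_left_mono mult_pos_pos power_strict_mono)
  show "threshold \<longlonglongrightarrow> 1" unfolding threshold_def by real_asymp
next
  fix m :: nat and \<beta> x :: real
  assume m: "1 \<le> m" and \<beta>: "\<beta> \<in> {1<..threshold m}" and x: "x \<in> {0<..<1 / (\<beta> - 1)}"
  define n where "n = 2 * m + 1"
  have "expandingly_parametrized (real (n - 1) / real n) (beta_expansions \<beta> x)"
  proof (rule interior_point_parametrized[OF _ _ _ x])
    show "expandingly_parametrized (real (n - 1) / real n) (beta_expansions \<beta> y)"
      if "\<bar>y - 1 / (2 * (\<beta> - 1))\<bar> \<le> real n" for y
      using \<beta> m that power_le_if_le_threshold[of \<beta> m]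
      by (intro central_point_parametrized) (auto simp: n_def)
  qed (use \<beta> m in \<open>auto simp: n_def\<close>)
  then have "ereal (real (n - 1) / real n) \<le> hausdorff_dim (beta_expansions \<beta> x)"
    using m by (intro hausdorff_dim_ge_if_expandingly_parametrized) (auto simp: n_def)
  then show "ereal (2 * real m / (2 * real m + 1)) \<le> hausdorff_dim (beta_expansions \<beta> x)"
    by (simp add: n_def add.commute)
qed

end
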